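(* Let $\mathrm{Vir}=\mathbb{C}[\partial]L$ be the Virasoro Lie conformal algebra, with $[L_\lambda L]=(\partial+2\lambda)L$. Every conformal biderivation of $\mathrm{Vir}$ is an inner conformal biderivation.
   Context: All vector spaces, linear maps and tensor products are over $\mathbb{C}$. A Lie conformal algebra is a $\mathbb{C}[\partial]$-module $R$ with a $\mathbb{C}$-bilinear map $R\times R\to R[\lambda]$, $(x,y)\mapsto[x_\lambda y]$ (the $\lambda$-bracket), such that for all $x,y,z\in R$: (1) $[(\partial x)_\lambda y]=-\lambda[x_\lambda y]$; (2) $[x_\lambda y]=-[y_{-\partial-\lambda}x]$; (3) $[x_\lambda[y_\mu z]]=[[x_\lambda y]_{\lambda+\mu}z]+[y_\mu[x_\lambda z]]$. A conformal bilinear map $\phi_\lambda:R\times R\to R[\lambda]$ is a $\mathbb{C}$-bilinear map with $\phi_\lambda(\partial x,y)=-\lambda\phi_\lambda(x,y)$ and $\phi_\lambda(x,\partial y)=(\partial+\lambda)\phi_\lambda(x,y)$. A conformal biderivation of $R$ is a conformal bilinear map $\phi_\lambda:R\times R\to R[\lambda]$ such that for all $x,y,z\in R$: $\phi_\lambda(x,y)=-\phi_{-\partial-\lambda}(y,x)$ and $\phi_\lambda(x,[y_\mu z])=[(\phi_\lambda(x,y))_{\lambda+\mu}z]+[y_\mu\phi_\lambda(x,z)]$. A conformal biderivation $\phi_\lambda$ of $R$ is inner if there is $t\in\mathbb{C}$ such that $\phi_\lambda(x,y)=t[x_\lambda y]$ for all $x,y\in R$. Conventions: if $\phi_\lambda(y,x)=\sum_n\lambda^n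 c_n$ with $c_n\in R$, then $\phi_{-\partial-\lambda}(y,x)=\sum_n(-\partial-\lambda)^n c_n$ (and likewise for the bracket); brackets and $\phi$ are extended linearly over polynomials in the formal variables, e.g. $[(\phi_\lambda(x,y))_{\lambda+\mu}z]=\sum_n\lambda^n[{c_n}_{\lambda+\mu}z]$ if $\phi_\lambda(x,y)=\sum_n\lambda^n c_n$. $\mathrm{Vir}$ is the free $\mathbb{C}[\partial]$-module of rank one with basis $L$ and the $\lambda$-bracket given in the claim. *)

theory Defs
  imports Complex_Main "HOL-Computational_Algebra.Polynomial"
begin

text \<open>
  A \<open>\<complex>[\<partial>]\<close>-module \<open>R\<close> is a type \<open>'a\<close> with an action
  \<open>act :: complex poly \<Rightarrow> 'a \<Rightarrow> 'a\<close> satisfying the library locale \<^locale>\<open>module\<close>.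
  The polynomial space \<open>R[\<lambda>]\<close> is \<open>'a poly\<close>. The space \<open>R[\<lambda>,\<mu>]\<close> is
  \<open>'a poly poly\<close> read as \<open>R[\<lambda>][\<mu>]\<close>, so the inner variable is \<open>\<lambda>\<close> and the outer one
  is \<open>\<mu>\<close>.
\<close>

definition cscale :: "(complex poly \<Rightarrow> 'a \<Rightarrow> 'a) \<Rightarrow> complex \<Rightarrow> 'a \<Rightarrow> 'a"
  where "cscale act c x = act [:c:] x"

definition del :: "(complex poly \<Rightarrow> 'a \<Rightarrow> 'a) \<Rightarrow> 'a \<Rightarrow> 'a"
  where "del act x = act [:0, 1:] x"

definition times_var :: "'a::zero poly \<Rightarrow> 'a poly"
  where "times_var p = pCons 0 p"

definition times_lam :: "'a::zero poly poly \<Rightarrow> 'a poly poly"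
  where "times_lam = map_poly times_var"

definition times_mu :: "'a::zero poly poly \<Rightarrow> 'a poly poly"
  where "times_mu = times_var"

text \<open>
  \<open>subst_op T h (\<Sum>n. \<lambda>\<^sup>n c\<^sub>n) = (\<Sum>n. T\<^sup>n (h c\<^sub>n))\<close>: the variable is replaced by the
  operator \<open>T\<close>, and each coefficient \<open>c\<close> by \<open>h c\<close>.
\<close>
definition subst_op :: "('b \<Rightarrow> 'b) \<Rightarrow> ('a::zero \<Rightarrow> 'b) \<Rightarrow> 'a poly \<Rightarrow> 'b::comm_monoid_add"
  where "subst_op T h p = (\<Sum>n\<le>degree p. (T ^^ n) (h (coeff p n)))"

text \<open>The operator \<open>-\<partial>-\<lambda>\<close> on \<open>R[\<lambda>]\<close>, and the substitution \<open>\<lambda> \<mapsto> -\<partial>-\<lambda>\<close>.\<close>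
definition minus_del_lam ::
    "(complex poly \<Rightarrow> 'a \<Rightarrow> 'a) \<Rightarrow> 'a::ab_group_add poly \<Rightarrow> 'a poly"
  where "minus_del_lam act p = - map_poly (del act) p - times_var p"

definition flip :: "(complex poly \<Rightarrow> 'a \<Rightarrow> 'a) \<Rightarrow> 'a::ab_group_add poly \<Rightarrow> 'a poly"
  where "flip act p = subst_op (minus_del_lam act) (\<lambda>c. [:c:]) p"

text \<open>For \<open>p \<in> R[t]\<close>, the elements \<open>p(\<lambda>)\<close>, \<open>p(\<mu>)\<close> and \<open>p(\<lambda>+\<mu>)\<close> of \<open>R[\<lambda>,\<mu>]\<close>.\<close>
definition at_lam :: "'a::ab_group_add poly \<Rightarrow> 'a poly poly"
  where "at_lam p = subst_op times_lam (\<lambda>c. [:[:c:]:]) p"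

definition at_mu :: "'a::ab_group_add poly \<Rightarrow> 'a poly poly"
  where "at_mu p = subst_op times_mu (\<lambda>c. [:[:c:]:]) p"

definition at_lam_mu :: "'a::ab_group_add poly \<Rightarrow> 'a poly poly"
  where "at_lam_mu p = subst_op (\<lambda>q. times_lam q + times_mu q) (\<lambda>c. [:[:c:]:]) p"

definition cbilinear ::
    "(complex poly \<Rightarrow> 'a \<Rightarrow> 'a) \<Rightarrow> ('a::ab_group_add \<Rightarrow> 'a \<Rightarrow> 'a poly) \<Rightarrow> bool"
  where "cbilinear act f \<longleftrightarrow>
    (\<forall>y. Vector_Spaces.linear (cscale act) (\<lambda>c. map_poly (cscale act c)) (\<lambda>x. f x y)) \<and>
    (\<forall>x. Vector_Spaces.linear (cscale act) (\<lambda>c. map_poly (cscale act c)) (\<lambda>y. f x y))"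

text \<open>In the last axiom the three terms are \<open>[x\<^sub>\<lambda> [y\<^sub>\<mu> z]]\<close>,
  \<open>[[x\<^sub>\<lambda> y]\<^bsub>\<lambda>+\<mu>\<^esub> z]\<close> and \<open>[y\<^sub>\<mu> [x\<^sub>\<lambda> z]]\<close>.\<close>
locale lie_conformal_algebra = module act
  for act :: "complex poly \<Rightarrow> 'a \<Rightarrow> 'a::ab_group_add" +
  fixes br :: "'a \<Rightarrow> 'a \<Rightarrow> 'a poly"
  assumes br_bilinear: "cbilinear act br"
    and br_del_left: "br (del act x) y = - times_var (br x y)"
    and br_skew: "br x y = - flip act (br y x)"
    and br_jacobi:
      "subst_op times_mu (\<lambda>c. at_lam (br x c)) (br y z) =
       subst_op times_lam (\<lambda>c. at_lam_mu (br c z)) (br x y) +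
       subst_op times_lam (\<lambda>c. at_mu (br y c)) (br x z)"

definition conformal_bilinear ::
    "(complex poly \<Rightarrow> 'a \<Rightarrow> 'a) \<Rightarrow> ('a::ab_group_add \<Rightarrow> 'a \<Rightarrow> 'a poly) \<Rightarrow> bool"
  where "conformal_bilinear act \<phi> \<longleftrightarrow> cbilinear act \<phi> \<and>
    (\<forall>x y. \<phi> (del act x) y = - times_var (\<phi> x y)) \<and>
    (\<forall>x y. \<phi> x (del act y) = map_poly (del act) (\<phi> x y) + times_var (\<phi> x y))"

definition conformal_biderivation ::
    "(complex poly \<Rightarrow> 'a \<Rightarrow> 'a) \<Rightarrow> ('a \<Rightarrow> 'a \<Rightarrow> 'a poly) \<Rightarrow>
     ('a::ab_group_add \<Rightarrow> 'a \<Rightarrow> 'a poly) \<Rightarrow> bool"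
  where "conformal_biderivation act br \<phi> \<longleftrightarrow> conformal_bilinear act \<phi> \<and>
    (\<forall>x y. \<phi> x y = - flip act (\<phi> y x)) \<and>
    (\<forall>x y z.
      subst_op times_mu (\<lambda>c. at_lam (\<phi> x c)) (br y z) =
      subst_op times_lam (\<lambda>c. at_lam_mu (br c z)) (\<phi> x y) +
      subst_op times_lam (\<lambda>c. at_mu (br y c)) (\<phi> x z))"

definition inner_conformal_biderivation ::
    "(complex poly \<Rightarrow> 'a \<Rightarrow> 'a) \<Rightarrow> ('a \<Rightarrow> 'a \<Rightarrow> 'a poly) \<Rightarrow>
     ('a::ab_group_add \<Rightarrow> 'a \<Rightarrow> 'a poly) \<Rightarrow> bool"
  where "inner_conformal_biderivation act br \<phi> \<longleftrightarrow> conformal_biderivation act br \<phi> \<and>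
    (\<exists>t. \<forall>x y. \<phi> x y = map_poly (cscale act t) (br x y))"

text \<open>\<open>Vir\<close> is characterised by its defining data, which fix it up to the choice of the
  underlying free module; a model on \<^typ>\<open>complex poly\<close> with \<open>L = 1\<close> is given below.
  The last assumption is \<open>[L\<^sub>\<lambda> L] = (\<partial> + 2\<lambda>) L\<close>.\<close>
locale virasoro = lie_conformal_algebra act br
  for act :: "complex poly \<Rightarrow> 'a \<Rightarrow> 'a::ab_group_add"
    and br :: "'a \<Rightarrow> 'a \<Rightarrow> 'a poly" +
  fixes L :: 'a
  assumes L_independent: "independent {L}"
    and L_span: "span {L} = UNIV"
    and br_L_L: "br L L = [:del act L, cscale act 2 L:]"


text \<open>The model: \<open>ev f a = f(a)\<close> for \<open>f \<in> \<complex>[\<partial>]\<close> and \<open>a\<close> in a commutative ring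
  that contains \<open>\<complex>\<close> via \<open>i\<close>; the bracket is
  \<open>[f(\<partial>)L\<^sub>\<lambda> g(\<partial>)L] = f(-\<lambda>) g(\<partial>+\<lambda>) (\<partial>+2\<lambda>) L\<close>.\<close>
definition ev :: "('c::comm_ring_1 \<Rightarrow> 'b::comm_ring_1) \<Rightarrow> 'c poly \<Rightarrow> 'b \<Rightarrow> 'b"
  where "ev i f a = poly (map_poly i f) a"

definition vir_br :: "complex poly \<Rightarrow> complex poly \<Rightarrow> complex poly poly"
  where "vir_br f g = ev (\<lambda>c. [:[:c:]:]) f [:0, -1:] * ev (\<lambda>c. [:[:c:]:]) g [:[:0, 1:], 1:]
    * [:[:0, 1:], 2:]"

definition rhom :: "('c::comm_ring_1 \<Rightarrow> 'b::comm_ring_1) \<Rightarrow> bool"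
  where "rhom i \<longleftrightarrow> i 0 = 0 \<and> i 1 = 1 \<and> (\<forall>x y. i (x + y) = i x + i y) \<and> (\<forall>x y. i (x * y) = i x * i y)"

lemma map_poly_add_hom:
  assumes "h 0 = 0" "\<And>x y. h (x + y) = h x + h y"
  shows "map_poly h (p + q) = map_poly h p + map_poly h q"
  by (rule poly_eqI) (simp add: coeff_map_poly assms)

lemma ev_pCons: "rhom i \<Longrightarrow> ev i (pCons c f) a = i c + a * ev i f a"
  by (simp add: ev_def map_poly_pCons rhom_def)

lemma ev_0: "ev i 0 a = 0"
  by (simp add: ev_def)

lemma ev_add: "rhom i \<Longrightarrow> ev i (f + g) a = ev i f a + ev i g a"
  by (simp add: ev_def map_poly_add_hom rhom_def)

lemma ev_smult: "rhom i \<Longrightarrow> ev i (smult c f) a = i c * ev i f a"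
  by (induction f) (simp_all add: ev_0 ev_pCons rhom_def algebra_simps)

lemma ev_mult: "rhom i \<Longrightarrow> ev i (f * g) a = ev i f a * ev i g a"
  by (induction f) (simp_all add: ev_0 ev_pCons ev_add ev_smult rhom_def algebra_simps)

lemma rhom_ev: "rhom i \<Longrightarrow> rhom (\<lambda>f. ev i f a)"
  unfolding rhom_def[of "\<lambda>f. ev i f a"]
  by (simp add: ev_0 ev_add ev_mult)
     (simp add: rhom_def ev_def map_poly_1)

lemma ev_sum:
  assumes "rhom i"
  shows "ev i p t = (\<Sum>n\<le>degree p. i (coeff p n) * t ^ n)"
proof -
  have i0: "i 0 = 0" using assms by (simp add: rhom_def)
  have "degree (map_poly i p) \<le> degree p" by (rule degree_le) (simp add: coeff_map_poly i0 coeff_eq_0)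
  then have "(\<Sum>n\<le>degree (map_poly i p). coeff (map_poly i p) n * t ^ n) =
      (\<Sum>n\<le>degree p. coeff (map_poly i p) n * t ^ n)"
    by (intro sum.mono_neutral_left) (auto simp: coeff_eq_0 not_le)
  then show ?thesis
    by (simp add: ev_def poly_altdef coeff_map_poly i0)
qed

lemma subst_op_ev:
  assumes "rhom j" "\<And>q. T q = t * q" "\<And>c. h c = j c * K"
  shows "subst_op T h p = ev j p t * (K :: 'b::comm_ring_1)"
proof -
  have "(T ^^ n) q = t ^ n * q" for n q
    by (induction n) (simp_all add: assms(2) mult.assoc)
  then show ?thesis
    by (simp add: subst_op_def ev_sum[OF assms(1)] assms(3) sum_distrib_right sum_distrib_left mult_ac)
qed

lemma ev_ev:
  assumes "rhom i"
  shows "ev (\<lambda>f. ev i f d) (ev (\<lambda>c. [:[:c:]:]) f a) l = ev i f (ev (\<lambda>f. ev i f d) a l)"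
proof -
  have r: "rhom (\<lambda>c::'a. [:[:c:]:])" by (simp add: rhom_def one_pCons)
  note e = rhom_ev[OF assms, of d]
  have c: "ev (\<lambda>f. ev i f d) [:[:c:]:] l = i c" for c
    by (simp add: ev_pCons[OF e] ev_pCons[OF assms] ev_0)
  show ?thesis
    by (induction f) (simp_all add: ev_0 ev_pCons[OF r] ev_pCons[OF assms] ev_add[OF e] ev_mult[OF e] c)
qed

lemma ev_vir_br:
  assumes "rhom i"
  shows "ev (\<lambda>f. ev i f d) (vir_br f g) l = ev i f (- l) * ev i g (d + l) * (d + 2 * l)"
proof -
  note e = rhom_ev[OF assms, of d]
  have i1: "i 0 = 0" "i 1 = 1" and ia: "\<And>x y. i (x + y) = i x + i y"
    using assms by (simp_all add: rhom_def)
  have im: "i (- 1) = - 1"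
    using ia[of 1 "- 1"] i1 by (simp add: add_eq_0_iff)
  have i2: "i 2 = 2"
    using ia[of 1 1] i1 by simp
  show ?thesis
    unfolding vir_br_def ev_mult[OF e] ev_ev[OF assms]
    by (simp add: ev_pCons[OF e] ev_pCons[OF assms] ev_0 i1 im i2
        one_pCons numeral_poly mult_ac)
qed

lemma rhom_const: "rhom (\<lambda>c. [:c:])" "rhom (\<lambda>c. [:[:c:]:])" "rhom (\<lambda>c. [:[:[:c:]:]:])"
  by (simp_all add: rhom_def one_pCons)

lemma ev_const1: "ev (\<lambda>c. [:[:c:]:]) f [:[:0, 1:]:] = [:f:]"
  by (induction f) (simp_all add: ev_0 ev_pCons rhom_const)

lemma ev_const2: "ev (\<lambda>c. [:[:[:c:]:]:]) f [:[:[:0, 1:]:]:] = [:[:f:]:]"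
  by (induction f) (simp_all add: ev_0 ev_pCons rhom_const)

lemma cscale_mult: "cscale (*) c = (\<lambda>f. [:c:] * f)"
  by (rule ext) (simp add: cscale_def)

lemma del_mult: "del (*) = (\<lambda>f. [:0, 1:] * f)"
  by (rule ext) (simp add: del_def)

lemma map_poly_mult: "map_poly (\<lambda>f. a * f) p = [:a:] * (p :: 'b::comm_ring_1 poly)"
  by (rule poly_eqI) (simp add: coeff_map_poly)

lemma times_var_mult: "times_var p = [:0, 1:] * (p :: 'b::comm_ring_1 poly)"
  by (simp add: times_var_def)

lemma times_mu_mult: "times_mu p = [:0, 1:] * (p :: 'b::comm_ring_1 poly poly)"
  by (simp add: times_mu_def times_var_mult)

lemma times_lam_mult: "times_lam p = [:[:0, 1:]:] * (p :: 'b::comm_ring_1 poly poly)"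
  unfolding times_lam_def
  by (subst map_poly_mult[symmetric], rule map_poly_cong) (simp add: times_var_mult)

lemma at_vir_br:
  fixes f g :: "complex poly"
  defines "i \<equiv> \<lambda>c::complex. [:[:[:c:]:]:]" and "d \<equiv> [:[:[:0, 1:]:]:]"
    and "l \<equiv> [:[:0, 1:]:]" and "m \<equiv> [:0, 1:]"
  shows "at_lam (vir_br f g) = ev i f (- l) * ev i g (d + l) * (d + 2 * l)"
    and "at_mu (vir_br f g) = ev i f (- m) * ev i g (d + m) * (d + 2 * m)"
    and "at_lam_mu (vir_br f g) = ev i f (- (l + m)) * ev i g (d + (l + m)) * (d + 2 * (l + m))"
proof -
  have ri: "rhom i" unfolding i_def by (rule rhom_const)
  note e = rhom_ev[OF ri, of d]
  have h: "[:[:c:]:] = ev i c d * 1" for c unfolding i_def d_def by (simp add: ev_const2)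
  show "at_lam (vir_br f g) = ev i f (- l) * ev i g (d + l) * (d + 2 * l)"
    unfolding at_lam_def
    by (subst subst_op_ev[where t = l, OF e _ h]) (simp_all add: times_lam_mult l_def ev_vir_br[OF ri])
  show "at_mu (vir_br f g) = ev i f (- m) * ev i g (d + m) * (d + 2 * m)"
    unfolding at_mu_def
    by (subst subst_op_ev[where t = m, OF e _ h]) (simp_all add: times_mu_mult m_def ev_vir_br[OF ri])
  show "at_lam_mu (vir_br f g) = ev i f (- (l + m)) * ev i g (d + (l + m)) * (d + 2 * (l + m))"
    unfolding at_lam_mu_def
    by (subst subst_op_ev[where t = "l + m", OF e _ h])
      (simp_all only: times_lam_mult times_mu_mult l_def m_def ev_vir_br[OF ri] mult_1_right distrib_right)
qed

lemma vir_jacobi: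
  "subst_op times_mu (\<lambda>c. at_lam (vir_br x c)) (vir_br y z) =
   subst_op times_lam (\<lambda>c. at_lam_mu (vir_br c z)) (vir_br x y) +
   subst_op times_lam (\<lambda>c. at_mu (vir_br y c)) (vir_br x z)"
proof -
  define i where "i = (\<lambda>c::complex. [:[:[:c:]:]:])"
  define d l m :: "complex poly poly poly"
    where "d = [:[:[:0, 1:]:]:]" and "l = [:[:0, 1:]:]" and "m = [:0, 1:]"
  have ri: "rhom i" unfolding i_def by (rule rhom_const)
  note e = rhom_ev[OF ri] and at = at_vir_br[folded i_def d_def l_def m_def]
  have 1: "subst_op times_mu (\<lambda>c. at_lam (vir_br x c)) (vir_br y z) =
      ev (\<lambda>c. ev i c (d + l)) (vir_br y z) m * (ev i x (- l) * (d + 2 * l))"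
    by (rule subst_op_ev[OF e]) (simp_all add: at times_mu_mult m_def mult_ac)
  have 2: "subst_op times_lam (\<lambda>c. at_lam_mu (vir_br c z)) (vir_br x y) =
      ev (\<lambda>c. ev i c (- (l + m))) (vir_br x y) l * (ev i z (d + (l + m)) * (d + 2 * (l + m)))"
    by (rule subst_op_ev[OF e]) (simp_all only: at times_lam_mult l_def mult_ac)
  have 3: "subst_op times_lam (\<lambda>c. at_mu (vir_br y c)) (vir_br x z) =
      ev (\<lambda>c. ev i c (d + m)) (vir_br x z) l * (ev i y (- m) * (d + 2 * m))"
    by (rule subst_op_ev[OF e]) (simp_all add: at times_lam_mult l_def mult_ac)
  have a: "- (l + m) + l = - m" "d + l + m = d + (l + m)" "d + m + l = d + (l + m)"
    by simp_all
  show ?thesis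
    unfolding 1 2 3 ev_vir_br[OF ri] a by algebra
qed

lemma vir_skew: "vir_br x y = - flip (*) (vir_br y x)"
proof -
  define i where "i = (\<lambda>c::complex. [:[:c:]:])"
  define d l :: "complex poly poly" where "d = [:[:0, 1:]:]" and "l = [:0, 1:]"
  have ri: "rhom i" unfolding i_def by (rule rhom_const)
  have h: "[:c:] = ev i c d * 1" for c
    unfolding i_def d_def by (simp add: ev_const1)
  have "minus_del_lam (*) q = (- d - l) * q" for q
    unfolding minus_del_lam_def del_mult map_poly_mult times_var_mult d_def l_def
    by (simp only: left_diff_distrib mult_minus_left)
  then have f: "flip (*) (vir_br y x) = ev (\<lambda>c. ev i c d) (vir_br y x) (- d - l) * 1"
    unfolding flip_def by (rule subst_op_ev[OF rhom_ev[OF ri] _ h])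
  have v: "vir_br x y = ev i x (- l) * ev i y (d + l) * (d + 2 * l)"
    by (simp add: vir_br_def i_def d_def l_def numeral_poly mult_ac)
  have a: "- (- d - l) = d + l" "d + (- d - l) = - l" "d + 2 * (- d - l) = - (d + 2 * l)"
    by (simp_all add: algebra_simps)
  show ?thesis
    unfolding f v ev_vir_br[OF ri] a by algebra
qed

theorem virasoro_model: "virasoro (*) vir_br 1"
proof -
  interpret M: module "(*) :: complex poly \<Rightarrow> _"
    by unfold_locales (simp_all add: algebra_simps)
  have vs1: "vector_space (cscale ((*) :: complex poly \<Rightarrow> _))"
    by unfold_locales (simp_all add: cscale_mult algebra_simps smult_add_left smult_add_right)
  have vs2: "vector_space (\<lambda>c. map_poly (cscale ((*) :: complex poly \<Rightarrow> _) c))"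
    by unfold_locales
      (rule poly_eqI, simp add: coeff_map_poly cscale_def smult_add_right smult_add_left)+
  have r: "rhom (\<lambda>c::complex. [:[:c:]:])" by (rule rhom_const)
  have ms: "map_poly (cscale (*) c) p = smult [:c:] p" for c and p :: "complex poly poly"
    by (rule poly_eqI) (simp add: coeff_map_poly cscale_def)
  have cs: "cscale (*) c f = smult c f" for c and f :: "complex poly"
    by (simp add: cscale_def)
  have bil: "cbilinear (*) vir_br"
    unfolding cbilinear_def
    by (intro conjI allI linear_module_homI module_hom.intro module_hom_axioms.intro;
        (rule vs1[folded module_iff_vector_space] vs2[folded module_iff_vector_space])?)
       (simp_all add: ms cs vir_br_def ev_add[OF r] ev_smult[OF r] algebra_simps)
  show ?thesis
  proof
    show "cbilinear (*) vir_br" by (rule bil)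
    show "vir_br (del (*) x) y = - times_var (vir_br x y)" for x y
    proof -
      have "ev (\<lambda>c. [:[:c:]:]) ([:0, 1:] * x) [:0, -1:] =
          - ([:0, 1:] * ev (\<lambda>c. [:[:c:]:]) x [:0, -1:])"
        by (simp add: ev_mult[OF r] ev_pCons[OF r] ev_0)
      then show ?thesis
        unfolding del_mult times_var_mult vir_br_def by algebra
    qed
    show "M.independent {1}"
    proof -
      have "u v = 0" if "t \<subseteq> {1}" "(\<Sum>w\<in>t. u w * w) = 0" "v \<in> t"
        for t and u :: "complex poly \<Rightarrow> complex poly" and v
      proof -
        have "t = {1}" "v = 1" using that(1,3) by blast+
        then show ?thesis using that(2) by simp
      qed
      then show ?thesis
        unfolding M.dependent_explicit by blast
    qed
    show "M.span {1} = UNIV"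
      by (simp add: M.span_singleton)
    show "vir_br 1 1 = [:del (*) 1, cscale (*) 2 1:]"
      by (simp add: vir_br_def one_pCons ev_pCons[OF r] ev_0 del_def cscale_def numeral_poly)
  qed (rule vir_skew vir_jacobi)+
qed

end

theory Submission
  imports Defs
begin

text \<open>
  A point \<open>(d, l)\<close> of \<open>\<complex>\<^sup>2\<close> turns an element of \<open>Vir[\<lambda>]\<close> into a number, by \<open>\<partial> \<mapsto> d\<close>,
  \<open>\<lambda> \<mapsto> l\<close>, \<open>L \<mapsto> 1\<close>, and an element of \<open>Vir[\<lambda>]\<close> is determined by these numbers
  (\<open>ev2_eqI\<close>). Every skew conformal bilinear map is determined by its value at \<open>(L, L)\<close>
  (\<open>ev2_skew_conformal\<close>), so a biderivation \<open>\<phi>\<close> amounts to one function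
  \<open>F d l\<close>, the value of \<open>\<phi>\<^sub>\<lambda>(L, L)\<close>, which is polynomial in \<open>d\<close>; the bracket itself has the
  function \<open>d + 2 l\<close>. The claim becomes \<open>F d l = t (d + 2 l)\<close> for a constant \<open>t\<close>.

  The derivation rule at \<open>x = y = z = L\<close> reads
  \<open>(d + l + 2 m) F d l = (d + 2 (l + m)) F (- l - m) l + (d + 2 m) F (d + m) l\<close>.
  The choice \<open>m = - d/2\<close> removes the last term and leaves, for \<open>l \<noteq> 0\<close>,
  \<open>F d l = 2 F (d/2 - l) l\<close>. In the coordinate \<open>x = d + 2 l\<close> this says \<open>h x = 2 h (x/2)\<close> for a
  polynomial \<open>h\<close>; only linear polynomials satisfy it, whence \<open>F d l = q l (d + 2 l)\<close>.
  Skew-symmetry, \<open>F d l = - F d (- d - l)\<close>, exchanges \<open>l\<close> with the arbitrary value \<open>- d - l\<close> and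
  changes the sign of \<open>d + 2 l\<close>, so \<open>q\<close> is constant.
\<close>

section \<open>The functional equation\<close>

text \<open>The coefficients satisfy \<open>c\<^sub>n = 2 c\<^sub>n / 2\<^sup>n\<close>, which kills all of them but \<open>c\<^sub>1\<close>.\<close>
lemma poly_eq_double_half_imp_linear:
  fixes p :: "complex poly"
  assumes "\<And>x. poly p x = 2 * poly p (x / 2)"
  shows "poly p x = x * poly p 1"
proof -
  have "poly p = poly (smult 2 (p \<circ>\<^sub>p [:0, 1 / 2:]))"
  proof
    fix x
    show "poly p x = poly (smult 2 (p \<circ>\<^sub>p [:0, 1 / 2:])) x"
      using assms[of x] by (simp add: poly_pcompose)
  qed
  then have eq: "p = smult 2 (p \<circ>\<^sub>p [:0, 1 / 2:])"
    by (simp only: poly_eq_poly_eq_iff)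
  have c: "coeff p n = 0" if "n \<noteq> 1" for n
  proof -
    have "coeff p n = 2 * ((1 / 2) ^ n * coeff p n)"
      by (subst eq) (simp add: coeff_pcompose_linear)
    moreover have "(2::complex) * (1 / 2) ^ n \<noteq> 1"
    proof
      assume "(2::complex) * (1 / 2) ^ n = 1"
      then have "(2::complex) ^ n = 2 ^ 1"
        by (simp add: field_simps)
      then have "of_nat (2 ^ n) = (of_nat (2 ^ 1) :: complex)"
        by simp
      then have "(2::nat) ^ n = 2 ^ 1"
        by (simp only: of_nat_eq_iff)
      then show False
        using that by (simp only: power_inject_exp)
    qed
    ultimately show ?thesis
      by (metis mult.assoc mult_cancel_right1 mult.commute)
  qed
  have "p = [:0, coeff p 1:]"
    by (rule poly_eqI) (auto simp: coeff_pCons c split: nat.split)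
  then have "poly p y = y * coeff p 1" for y
    by (metis poly_pCons poly_0 add.left_neutral mult_zero_right add.right_neutral)
  then show ?thesis
    by simp
qed

lemma derivation_equation_solution:
  fixes F :: "complex \<Rightarrow> complex \<Rightarrow> complex"
  assumes pol: "\<And>l. \<exists>p. \<forall>d. F d l = poly p d"
    and skew: "\<And>d l. F d l = - F d (- d - l)"
    and der: "\<And>d l m. (d + l + 2 * m) * F d l
        = (d + 2 * (l + m)) * F (- l - m) l + (d + 2 * m) * F (d + m) l"
  obtains t where "\<And>d l. F d l = t * (d + 2 * l)"
proof -
  define q where "q l = F (1 - 2 * l) l" for l
  have F_q: "F d l = q l * (d + 2 * l)" if "l \<noteq> 0" for d l
  proof -
    obtain p where p: "\<And>d. F d l = poly p d"
      using pol by blast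
    define h where "h = p \<circ>\<^sub>p [:- 2 * l, 1:]"
    have h: "poly h x = F (x - 2 * l) l" for x
      by (simp add: h_def p poly_pcompose)
    have half: "F d l = 2 * F (d / 2 - l) l" for d
    proof -
      have "l * F d l = l * (2 * F (- l - (- d / 2)) l)"
        using der[of d l "- d / 2"] by simp
      also have "- l - (- d / 2) = d / 2 - l"
        by simp
      finally show ?thesis
        using that by simp
    qed
    have "poly h x = 2 * poly h (x / 2)" for x
    proof -
      have "(x - 2 * l) / 2 - l = x / 2 - 2 * l"
        by (simp add: field_simps)
      then show ?thesis
        using half[of "x - 2 * l"] by (simp only: h)
    qed
    then have "poly h (d + 2 * l) = (d + 2 * l) * poly h 1"
      by (rule poly_eq_double_half_imp_linear)
    then show ?thesis
      by (simp add: h q_def)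
  qed
  have q_const: "q l = q k" if "l \<noteq> 0" "k \<noteq> 0" for l k
  proof (cases "l = k")
    case False
    have "q l * (l - k) = q k * (l - k)"
      using skew[of "- l - k" l] that by (simp add: F_q algebra_simps)
    then show ?thesis
      using False by simp
  qed simp
  have F: "F d l = q 1 * (d + 2 * l)" if "l \<noteq> 0" for d l
    using F_q[OF that] q_const[OF that, of 1] by simp
  \<comment> \<open>The line \<open>l = 0\<close>, where \<open>l\<close> cannot be cancelled, is reached by skew-symmetry.\<close>
  have "F d 0 = q 1 * (d + 2 * 0)" for d
  proof (cases "d = 0")
    case True
    then show ?thesis
      using skew[of 0 0] by (simp add: equal_neg_zero)
  next
    case False
    then show ?thesis
      using skew[of d 0] F[of "- d" d] by (simp add: algebra_simps)
  qed
  with F show ?thesis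
    using that[of "q 1"] by metis
qed

section \<open>Evaluation at complex points\<close>

text \<open>The substitutions in the axioms are all instances of \<open>subst_op\<close>; this is how an additive
  functional \<open>e\<close> that diagonalises the substituted operator sees one of them.\<close>
lemma additive_subst_op:
  fixes e :: "'b::comm_monoid_add \<Rightarrow> complex"
  assumes e: "e 0 = 0" "\<And>x y. e (x + y) = e x + e y"
    and T: "\<And>x. e (T x) = t * e x"
    and h: "\<And>c. e (h c) = g c * k"
    and g: "g 0 = 0"
  shows "e (subst_op T h p) = poly (map_poly g p) t * k"
proof -
  have e_sum: "e (sum f A) = (\<Sum>n\<in>A. e (f n))" for f :: "nat \<Rightarrow> 'b" and A
    by (induction A rule: infinite_finite_induct) (simp_all add: e)
  have e_funpow: "e ((T ^^ n) x) = t ^ n * e x" for n x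
    by (induction n) (simp_all add: T)
  have "degree (map_poly g p) \<le> degree p"
    by (rule degree_le) (simp add: coeff_map_poly g coeff_eq_0)
  then have "poly (map_poly g p) t = (\<Sum>n\<le>degree p. coeff (map_poly g p) n * t ^ n)"
    unfolding poly_altdef by (intro sum.mono_neutral_left) (auto simp: coeff_eq_0 not_le)
  then show ?thesis
    by (simp add: subst_op_def e_sum e_funpow h coeff_map_poly g sum_distrib_left
        sum_distrib_right mult_ac)
qed

context virasoro
begin

definition ev1 :: "complex \<Rightarrow> 'a \<Rightarrow> complex"
  where "ev1 d x = poly (representation {L} x L) d"

definition ev2 :: "complex \<Rightarrow> complex \<Rightarrow> 'a poly \<Rightarrow> complex"
  where "ev2 d l P = poly (map_poly (ev1 d) P) l"

definition ev3 :: "complex \<Rightarrow> complex \<Rightarrow> complex \<Rightarrow> 'a poly poly \<Rightarrow> complex"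
  where "ev3 d l m Q = poly (map_poly (ev2 d l) Q) m"

lemma ev1_add: "ev1 d (x + y) = ev1 d x + ev1 d y"
  by (simp add: ev1_def representation_add L_independent L_span)

lemma ev1_act: "ev1 d (act p x) = poly p d * ev1 d x"
  by (simp add: ev1_def representation_scale L_independent L_span)

lemma ev1_L: "ev1 d L = 1"
  by (simp add: ev1_def representation_basis L_independent)

lemma ev1_0: "ev1 d 0 = 0"
  using ev1_add[of d 0 0] by simp

lemma ev1_minus: "ev1 d (- x) = - ev1 d x"
  using ev1_add[of d x "- x"] by (simp add: ev1_0 add_eq_0_iff)

lemma ev1_cscale: "ev1 d (cscale act c x) = c * ev1 d x"
  by (simp add: cscale_def ev1_act)

lemma ev1_del: "ev1 d (del act x) = d * ev1 d x"
  by (simp add: del_def ev1_act)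

lemma obtain_coordinate:
  obtains p where "x = act p L"
proof -
  have "(\<Sum>b\<in>{L}. act (representation {L} x b) b) = x"
    by (rule sum_representation_eq) (simp_all add: L_independent L_span)
  then show ?thesis
    by (intro that[of "representation {L} x L"]) simp
qed

lemma ev1_eq_0D:
  assumes "\<And>d. ev1 d x = 0"
  shows "x = 0"
proof -
  obtain p where p: "x = act p L"
    by (rule obtain_coordinate)
  have "poly p = poly 0"
    using assms by (auto simp: p ev1_act ev1_L)
  then have "p = 0"
    by (simp only: poly_eq_poly_eq_iff)
  then show ?thesis
    by (simp add: p)
qed

lemma ev2_0: "ev2 d l 0 = 0"
  by (simp add: ev2_def)

lemma ev2_pCons: "ev2 d l (pCons c P) = ev1 d c + l * ev2 d l P"
  by (simp add: ev2_def map_poly_pCons ev1_0)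

lemma ev2_add: "ev2 d l (P + Q) = ev2 d l P + ev2 d l Q"
  by (simp add: ev2_def map_poly_add_hom ev1_add ev1_0)

lemma ev2_minus: "ev2 d l (- P) = - ev2 d l P"
  using ev2_add[of d l P "- P"] by (simp add: ev2_0 add_eq_0_iff)

lemma ev2_diff: "ev2 d l (P - Q) = ev2 d l P - ev2 d l Q"
  using ev2_add[of d l P "- Q"] by (simp add: ev2_minus)

lemma ev2_times_var: "ev2 d l (times_var P) = l * ev2 d l P"
  by (simp add: times_var_def ev2_pCons ev1_0)

lemma ev2_map_poly:
  assumes "h 0 = 0" "\<And>c. ev1 d (h c) = k * ev1 d c"
  shows "ev2 d l (map_poly h P) = k * ev2 d l P"
  by (induction P)
    (simp_all add: ev2_0 ev2_pCons map_poly_pCons assms algebra_simps)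

lemma ev2_cscale: "ev2 d l (map_poly (cscale act c) P) = c * ev2 d l P"
  by (rule ev2_map_poly) (simp_all add: ev1_cscale, simp add: cscale_def)

lemma ev2_minus_del_lam: "ev2 d l (minus_del_lam act P) = (- d - l) * ev2 d l P"
proof -
  have "ev2 d l (map_poly (del act) P) = d * ev2 d l P"
    by (rule ev2_map_poly) (simp_all add: ev1_del, simp add: del_def)
  then show ?thesis
    by (simp add: minus_del_lam_def ev2_diff ev2_minus ev2_times_var algebra_simps)
qed

lemma ev2_flip: "ev2 d l (flip act P) = ev2 d (- d - l) P"
proof -
  have "ev2 d l (flip act P) = poly (map_poly (ev1 d) P) (- d - l) * 1"
    unfolding flip_def
    by (rule additive_subst_op)
      (simp_all only: ev2_0 ev2_add ev2_minus_del_lam ev2_pCons ev1_0 mult_zero_right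
        add_0_right mult_1_right)
  then show ?thesis
    by (simp only: ev2_def mult_1_right)
qed

lemma ev2_eqI:
  assumes "\<And>d l. ev2 d l P = ev2 d l Q"
  shows "P = Q"
proof -
  have "coeff (P - Q) n = 0" for n
  proof (rule ev1_eq_0D)
    fix d
    have "poly (map_poly (ev1 d) (P - Q)) = poly 0"
      using assms ev2_diff[of d _ P Q] by (auto simp: ev2_def)
    then have "map_poly (ev1 d) (P - Q) = 0"
      by (simp only: poly_eq_poly_eq_iff)
    then have "coeff (map_poly (ev1 d) (P - Q)) n = 0"
      by simp
    then show "ev1 d (coeff (P - Q) n) = 0"
      by (simp only: coeff_map_poly[of "ev1 d", OF ev1_0])
  qed
  then have "P - Q = 0"
    by (intro poly_eqI) simp
  then show ?thesis
    by simp
qed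

lemma ev2_polynomial_in_del: "\<exists>p. \<forall>d. ev2 d l P = poly p d"
proof (induction P)
  case 0
  then show ?case
    by (intro exI[of _ 0]) (simp add: ev2_0)
next
  case (pCons c P)
  then obtain p where "\<forall>d. ev2 d l P = poly p d"
    by blast
  then show ?case
    by (intro exI[of _ "representation {L} c L + smult l p"])
      (simp add: ev2_pCons ev1_def)
qed

lemma ev3_0: "ev3 d l m 0 = 0"
  by (simp add: ev3_def)

lemma ev3_pCons: "ev3 d l m (pCons P Q) = ev2 d l P + m * ev3 d l m Q"
  by (simp add: ev3_def map_poly_pCons ev2_0)

lemma ev3_add: "ev3 d l m (P + Q) = ev3 d l m P + ev3 d l m Q"
  by (simp add: ev3_def map_poly_add_hom ev2_add ev2_0)

lemma ev3_times_mu: "ev3 d l m (times_mu Q) = m * ev3 d l m Q"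
  by (simp add: times_mu_def times_var_def ev3_pCons ev2_0)

lemma ev3_times_lam: "ev3 d l m (times_lam Q) = l * ev3 d l m Q"
proof -
  have "times_var 0 = (0 :: 'a poly)"
    by (simp add: times_var_def)
  then show ?thesis
    unfolding times_lam_def
    by (induction Q)
      (simp_all add: ev3_0 ev3_pCons map_poly_pCons ev2_times_var algebra_simps)
qed

text \<open>The embeddings of \<open>Vir[t]\<close> into \<open>Vir[\<lambda>, \<mu>]\<close>, with \<open>t\<close> read as \<open>\<lambda>\<close>, \<open>\<mu>\<close> or
  \<open>\<lambda> + \<mu>\<close>, substitute operators that have the eigenvalues \<open>l\<close>, \<open>m\<close> and \<open>l + m\<close> under
  evaluation.\<close>
lemma ev3_subst_const:
  assumes "\<And>Q. ev3 d l m (T Q) = t * ev3 d l m Q"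
  shows "ev3 d l m (subst_op T (\<lambda>c. [:[:c:]:]) P) = ev2 d t P"
proof -
  have "ev3 d l m (subst_op T (\<lambda>c. [:[:c:]:]) P) = poly (map_poly (ev1 d) P) t * 1"
    by (rule additive_subst_op)
      (simp_all only: assms ev3_0 ev3_add ev3_pCons ev2_pCons ev2_0 ev1_0 mult_zero_right
        add_0_right mult_1_right)
  then show ?thesis
    by (simp only: ev2_def mult_1_right)
qed

lemma ev3_at_lam: "ev3 d l m (at_lam P) = ev2 d l P"
  unfolding at_lam_def by (rule ev3_subst_const) (rule ev3_times_lam)

lemma ev3_at_mu: "ev3 d l m (at_mu P) = ev2 d m P"
  unfolding at_mu_def by (rule ev3_subst_const) (rule ev3_times_mu)

lemma ev3_at_lam_mu: "ev3 d l m (at_lam_mu P) = ev2 d (l + m) P"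
  unfolding at_lam_mu_def
  by (rule ev3_subst_const) (simp add: ev3_add ev3_times_lam ev3_times_mu algebra_simps)

text \<open>Nested brackets are such substitutions. The second assumption is what sesquilinearity
  provides: a conformal bilinear map at parameter \<open>l\<close> sees its left argument only at
  \<open>\<partial> = - l\<close> and its right argument only at \<open>\<partial> = d + l\<close>.\<close>
lemma ev3_subst:
  assumes "\<And>Q. ev3 d l m (T Q) = t * ev3 d l m Q"
    and "\<And>c. ev3 d l m (h c) = ev1 d' c * k"
  shows "ev3 d l m (subst_op T h P) = ev2 d' t P * k"
  unfolding ev2_def
  by (rule additive_subst_op) (simp_all add: assms ev3_0 ev3_add ev1_0)

section \<open>Skew conformal bilinear maps\<close>

text \<open>The common properties of the bracket and of a biderivation. Sesquilinearity in the second
  argument follows from that in the first by skew-symmetry.\<close>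
definition skew_conformal :: "('a \<Rightarrow> 'a \<Rightarrow> 'a poly) \<Rightarrow> bool"
  where "skew_conformal f \<longleftrightarrow> cbilinear act f \<and>
    (\<forall>x y. f (del act x) y = - times_var (f x y)) \<and> (\<forall>x y. f x y = - flip act (f y x))"

lemma skew_conformal_br: "skew_conformal br"
  unfolding skew_conformal_def using br_bilinear br_del_left br_skew by blast

lemma skew_conformal_biderivation:
  "conformal_biderivation act br \<phi> \<Longrightarrow> skew_conformal \<phi>"
  unfolding skew_conformal_def conformal_biderivation_def conformal_bilinear_def by blast

lemma ev2_skew:
  assumes "skew_conformal f"
  shows "ev2 d l (f x y) = - ev2 d (- d - l) (f y x)"
proof -
  have "f x y = - flip act (f y x)"
    using assms unfolding skew_conformal_def by blast
  then have "ev2 d l (f x y) = ev2 d l (- flip act (f y x))"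
    by (rule arg_cong)
  then show ?thesis
    by (simp only: ev2_minus ev2_flip)
qed

lemma ev2_act_left:
  assumes "skew_conformal f"
  shows "ev2 d l (f (act p x) y) = poly p (- l) * ev2 d l (f x y)"
proof -
  have "Vector_Spaces.linear (cscale act) (\<lambda>c. map_poly (cscale act c)) (\<lambda>x. f x y)"
    using assms unfolding skew_conformal_def cbilinear_def by blast
  then interpret f: Vector_Spaces.linear "cscale act" "\<lambda>c. map_poly (cscale act c)" "\<lambda>x. f x y" .
  have del: "f (del act x) y = - times_var (f x y)" for x
    using assms unfolding skew_conformal_def by blast
  show ?thesis
  proof (induction p)
    case 0
    then show ?case
      by (simp add: f.zero ev2_0)
  next
    case (pCons c p)
    have "act (pCons c p) x = cscale act c x + del act (act p x)"
      by (simp add: cscale_def del_def flip: scale_left_distrib)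
    then show ?case
      by (simp only: f.add f.scale del ev2_add ev2_cscale ev2_minus ev2_times_var pCons)
        (simp add: algebra_simps)
  qed
qed

lemma ev2_left:
  assumes "skew_conformal f"
  shows "ev2 d l (f x y) = ev1 (- l) x * ev2 d l (f L y)"
  using obtain_coordinate[of x] ev2_act_left[OF assms] by (metis ev1_act ev1_L mult.right_neutral)

lemma ev2_right:
  assumes "skew_conformal f"
  shows "ev2 d l (f x y) = ev1 (d + l) y * ev2 d l (f x L)"
  using ev2_skew[OF assms, of d l x y] ev2_skew[OF assms, of d l x L]
    ev2_left[OF assms, of d "- d - l" y x] by (simp add: add.commute)

lemma ev2_skew_conformal:
  assumes "skew_conformal f"
  shows "ev2 d l (f x y) = ev1 (- l) x * ev1 (d + l) y * ev2 d l (f L L)"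
  using ev2_left[OF assms, of d l x y] ev2_right[OF assms, of d l L y] by simp

lemma ev2_br_L_L: "ev2 d l (br L L) = d + 2 * l"
  by (simp add: br_L_L ev2_pCons ev2_0 ev1_del ev1_cscale ev1_L)

section \<open>Biderivations\<close>

text \<open>The derivation rule at \<open>x = y = z = L\<close>. The coefficients of the inner value enter at
  \<open>\<partial> = d + l\<close>, \<open>\<partial> = - (l + m)\<close> and \<open>\<partial> = d + m\<close> respectively, according to their position in the
  outer map.\<close>
lemma derivation_equation:
  assumes "conformal_biderivation act br \<phi>"
  defines "F \<equiv> \<lambda>d l. ev2 d l (\<phi> L L)"
  shows "(d + l + 2 * m) * F d l
    = (d + 2 * (l + m)) * F (- l - m) l + (d + 2 * m) * F (d + m) l"
proof -
  have sk: "skew_conformal \<phi>"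
    using assms(1) by (rule skew_conformal_biderivation)
  have "subst_op times_mu (\<lambda>c. at_lam (\<phi> L c)) (br L L) =
      subst_op times_lam (\<lambda>c. at_lam_mu (br c L)) (\<phi> L L) +
      subst_op times_lam (\<lambda>c. at_mu (br L c)) (\<phi> L L)"
    using assms(1) unfolding conformal_biderivation_def by blast
  then have "ev3 d l m (subst_op times_mu (\<lambda>c. at_lam (\<phi> L c)) (br L L)) =
      ev3 d l m (subst_op times_lam (\<lambda>c. at_lam_mu (br c L)) (\<phi> L L)) +
      ev3 d l m (subst_op times_lam (\<lambda>c. at_mu (br L c)) (\<phi> L L))"
    by (simp add: ev3_add)
  moreover have "ev3 d l m (subst_op times_mu (\<lambda>c. at_lam (\<phi> L c)) (br L L))
      = ev2 (d + l) m (br L L) * F d l"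
    unfolding F_def
    by (rule ev3_subst[OF ev3_times_mu]) (unfold ev3_at_lam, rule ev2_right[OF sk])
  moreover have "ev3 d l m (subst_op times_lam (\<lambda>c. at_lam_mu (br c L)) (\<phi> L L))
      = F (- (l + m)) l * ev2 d (l + m) (br L L)"
    unfolding F_def
    by (rule ev3_subst[OF ev3_times_lam])
      (unfold ev3_at_lam_mu, rule ev2_left[OF skew_conformal_br])
  moreover have "ev3 d l m (subst_op times_lam (\<lambda>c. at_mu (br L c)) (\<phi> L L))
      = F (d + m) l * ev2 d m (br L L)"
    unfolding F_def
    by (rule ev3_subst[OF ev3_times_lam])
      (unfold ev3_at_mu, rule ev2_right[OF skew_conformal_br])
  ultimately show ?thesis
    by (simp add: ev2_br_L_L mult.commute)
qed

lemma biderivation_multiple_of_bracket: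
  assumes "conformal_biderivation act br \<phi>"
  shows "\<exists>t. \<forall>x y. \<phi> x y = map_poly (cscale act t) (br x y)"
proof -
  have sk: "skew_conformal \<phi>"
    using assms by (rule skew_conformal_biderivation)
  obtain t where t: "\<And>d l. ev2 d l (\<phi> L L) = t * (d + 2 * l)"
    by (rule derivation_equation_solution[of "\<lambda>d l. ev2 d l (\<phi> L L)"])
      (blast intro: ev2_polynomial_in_del ev2_skew[OF sk] derivation_equation[OF assms])+
  have "\<phi> x y = map_poly (cscale act t) (br x y)" for x y
    by (rule ev2_eqI)
      (simp add: ev2_cscale ev2_skew_conformal[OF sk, of _ _ x y]
        ev2_skew_conformal[OF skew_conformal_br, of _ _ x y] t ev2_br_L_L)
  then show ?thesis
    by blast
qed

end

theorem corollary3p2: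
  fixes act :: "complex poly \<Rightarrow> 'a \<Rightarrow> 'a::ab_group_add"
    and br \<phi> :: "'a \<Rightarrow> 'a \<Rightarrow> 'a poly"
    and L :: 'a
  assumes "virasoro act br L"
    and "conformal_biderivation act br \<phi>"
  shows "inner_conformal_biderivation act br \<phi>"
proof -
  interpret virasoro act br L
    by (rule assms(1))
  show ?thesis
    unfolding inner_conformal_biderivation_def
    using assms(2) biderivation_multiple_of_bracket[OF assms(2)] by (rule conjI)
qed

end
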